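(* Let $X\subset\mathbb{R}^d$ be a finite set of $N$ augmented data samples, let $A\in\mathbb{R}_+^{N\times N}$ be the co-occurrence matrix with entries $A_{x,x'}=P(x,x')$ for $x,x'\in X$, where $P(x,x')$ is the co-occurrence (joint) probability of $x$ and $x'$, let $P(x)=\sum_{x'\in X}P(x,x')>0$ be its marginal, and let $\bar A=D^{-1/2}AD^{-1/2}$ be the normalized adjacency matrix, where $D$ is the diagonal matrix with $D_{x,x}=P(x)$. Let $f_+:\mathbb{R}^d\to\mathbb{R}^k$ be a representation function with $f_+(x)\ge 0$ (entrywise) for all $x\in X$, and let $F_+\in\mathbb{R}^{N\times k}$, $F_+\ge 0$, be the matrix with rows $(F_+)_{x,:}=\sqrt{P(x)}\,f_+(x)^\top$. Then $$\mathcal{L}_{\mathrm{SNMF}}(F):=\left\|\bar A-F_+F_+^\top\right\|^2=\sum_{x,x^+\in X}\frac{P(x,x^+)^2}{P(x)P(x^+)}-2\,\mathbb{E}_{x,x^+}\!\left[f_+(x)^\top f_+(x^+)\right]+\mathbb{E}_{x,x^-}\!\left[\left(f_+(x)^\top f_+(x^-)\right)^2\right]=\mathcal{L}_{\mathrm{NCL}}(f)+\mathrm{const},$$ where the constant $\sum_{x,x^+}\frac{P(x,x^+)^2}{P(x)P(x^+)}$ does not depend on $f_+$. Consequently, minimizing $\mathcal{L}_{\mathrm{SNMF}}(F)$ over non-negative $F_+$ is equivalent to minimizing $\mathcal{L}_{\mathrm{NCL}}(f)$ over non-negative representation functions, up to an additive constant.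
   Context: $\|\cdot\|$ on matrices is the Frobenius norm, and $\mathbb{R}_+$ denotes the non-negative reals. The co-occurrence probabilities arise from data augmentation: $\bar x$ is drawn from a distribution $\mathcal{P}(\bar x)$ of original samples, $\mathcal{A}(\cdot\mid\bar x)$ is the augmentation distribution on $X$ given $\bar x$, and $P(x,x')=\mathbb{E}_{\bar x}[\mathcal{A}(x\mid\bar x)\,\mathcal{A}(x'\mid\bar x)]$; thus $P$ is a symmetric probability distribution on $X\times X$. A positive pair $(x,x^+)$ is distributed according to $P(x,x^+)$, so $\mathbb{E}_{x,x^+}[g(x,x^+)]=\sum_{x,x^+}P(x,x^+)g(x,x^+)$. A negative pair $(x,x^-)$ consists of two independent draws from the marginal $P(x)$, so $\mathbb{E}_{x,x^-}[g(x,x^-)]=\sum_{x,x^-}P(x)P(x^-)g(x,x^-)$. The non-negative contrastive learning (NCL) loss is $$\mathcal{L}_{\mathrm{NCL}}(f)=-2\,\mathbb{E}_{x,x^+}\!\left[f_+(x)^\top f_+(x^+)\right]+\mathbb{E}_{x,x^-}\!\left[\left(f_+(x)^\top f_+(x^-)\right)^2\right].$$ *)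

theory Defs
  imports "HOL-Analysis.Analysis" "HOL-Probability.Probability"
begin

subsection \<open>Co-occurrence probabilities from data augmentation\<close>

definition cooccurrence :: "'o measure \<Rightarrow> ('o \<Rightarrow> 'a pmf) \<Rightarrow> 'a \<Rightarrow> 'a \<Rightarrow> real" where
  "cooccurrence M aug x x' = (LINT z|M. pmf (aug z) x * pmf (aug z) x')"

definition marginal :: "'a set \<Rightarrow> ('a \<Rightarrow> 'a \<Rightarrow> real) \<Rightarrow> 'a \<Rightarrow> real" where
  "marginal X P x = (\<Sum>x'\<in>X. P x x')"

definition augmentation_model :: "'a set \<Rightarrow> 'o measure \<Rightarrow> ('o \<Rightarrow> 'a pmf) \<Rightarrow> bool" where
  "augmentation_model X M aug \<longleftrightarrow>
     prob_space M \<and>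
     (\<forall>z\<in>space M. set_pmf (aug z) \<subseteq> X) \<and>
     (\<forall>x\<in>X. (\<lambda>z. pmf (aug z) x) \<in> borel_measurable M)"

text \<open>
  \<^const>\<open>embed_pmf\<close> and the integral are meaningful because \<^const>\<open>augmentation_model\<close> makes
  \<^const>\<open>cooccurrence\<close> a probability mass function on \<open>X \<times> X\<close>; see \<open>pmf_positive_pair\<close>.
\<close>

definition positive_pair :: "('a \<Rightarrow> 'a \<Rightarrow> real) \<Rightarrow> ('a \<times> 'a) pmf" where
  "positive_pair P = embed_pmf (\<lambda>(x, x'). P x x')"

definition negative_pair :: "('a \<Rightarrow> 'a \<Rightarrow> real) \<Rightarrow> ('a \<times> 'a) pmf" where
  "negative_pair P = pair_pmf (map_pmf fst (positive_pair P)) (map_pmf fst (positive_pair P))"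


subsection \<open>The two losses\<close>

definition L_NCL :: "('a \<Rightarrow> 'a \<Rightarrow> real) \<Rightarrow> ('a \<Rightarrow> real ^ 'k) \<Rightarrow> real" where
  "L_NCL P f =
     - 2 * measure_pmf.expectation (positive_pair P) (\<lambda>(x, x'). f x \<bullet> f x')
     + measure_pmf.expectation (negative_pair P) (\<lambda>(x, x'). (f x \<bullet> f x')\<^sup>2)"

text \<open>
  Matrices whose rows or columns are indexed by the points of \<open>X\<close> have a finite index type \<open>'n\<close>;
  the map \<open>s\<close> is a bijection from \<open>'n\<close> onto \<open>X\<close>.
\<close>

definition cooc_matrix :: "('n::finite \<Rightarrow> 'a) \<Rightarrow> ('a \<Rightarrow> 'a \<Rightarrow> real) \<Rightarrow> real ^ 'n ^ 'n" where
  "cooc_matrix s P = (\<chi> i j. P (s i) (s j))"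

definition degree_inv_sqrt ::
    "('n::finite \<Rightarrow> 'a) \<Rightarrow> 'a set \<Rightarrow> ('a \<Rightarrow> 'a \<Rightarrow> real) \<Rightarrow> real ^ 'n ^ 'n" where
  "degree_inv_sqrt s X P = (\<chi> i j. if i = j then marginal X P (s i) powr (- 1 / 2) else 0)"

definition normalized_adjacency ::
    "('n::finite \<Rightarrow> 'a) \<Rightarrow> 'a set \<Rightarrow> ('a \<Rightarrow> 'a \<Rightarrow> real) \<Rightarrow> real ^ 'n ^ 'n" where
  "normalized_adjacency s X P = degree_inv_sqrt s X P ** cooc_matrix s P ** degree_inv_sqrt s X P"

definition feature_matrix ::
    "('n::finite \<Rightarrow> 'a) \<Rightarrow> 'a set \<Rightarrow> ('a \<Rightarrow> 'a \<Rightarrow> real) \<Rightarrow> ('a \<Rightarrow> real ^ 'k) \<Rightarrow> real ^ 'k ^ 'n" where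
  "feature_matrix s X P f = (\<chi> i. sqrt (marginal X P (s i)) *\<^sub>R f (s i))"

text \<open>
  The norm of \<^typ>\<open>real ^ 'n ^ 'n\<close> is the Euclidean norm of the vector of row norms, that is, the
  Frobenius norm.
\<close>

definition L_SNMF ::
    "('n::finite \<Rightarrow> 'a) \<Rightarrow> 'a set \<Rightarrow> ('a \<Rightarrow> 'a \<Rightarrow> real) \<Rightarrow> real ^ 'k ^ 'n \<Rightarrow> real" where
  "L_SNMF s X P F = (norm (normalized_adjacency s X P - F ** transpose F))\<^sup>2"

definition nonneg_matrix :: "real ^ 'k ^ 'n \<Rightarrow> bool" where
  "nonneg_matrix F \<longleftrightarrow> (\<forall>i j. 0 \<le> F $ i $ j)"

definition nonneg_on :: "'a set \<Rightarrow> ('a \<Rightarrow> real ^ 'k) \<Rightarrow> bool" where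
  "nonneg_on X f \<longleftrightarrow> (\<forall>x\<in>X. \<forall>j. 0 \<le> f x $ j)"


subsection \<open>The pair distributions have the intended mass functions\<close>

lemma cooccurrence_outside:
  assumes "augmentation_model X M aug" "x \<notin> X \<or> x' \<notin> X"
  shows "cooccurrence M aug x x' = 0"
proof -
  have "pmf (aug z) x * pmf (aug z) x' = 0" if "z \<in> space M" for z
    using assms that unfolding augmentation_model_def by (auto simp: pmf_eq_0_set_pmf)
  then have "cooccurrence M aug x x' = (LINT z|M. 0)"
    unfolding cooccurrence_def by (intro Bochner_Integration.integral_cong) auto
  then show ?thesis by simp
qed

lemma pmf_positive_pair:
  assumes "augmentation_model X M aug" "finite X"
  shows "pmf (positive_pair (cooccurrence M aug)) (x, x') = cooccurrence M aug x x'"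
proof -
  interpret prob_space M using assms unfolding augmentation_model_def by blast
  let ?P = "cooccurrence M aug"
  have nonneg: "0 \<le> ?P u v" for u v
    unfolding cooccurrence_def by (simp add: integral_nonneg_AE)
  have int: "integrable M (\<lambda>z. pmf (aug z) u * pmf (aug z) v)" if "u \<in> X" "v \<in> X" for u v
    using assms that unfolding augmentation_model_def
    by (intro integrable_const_bound[where B = 1])
      (auto simp: pmf_le_1 mult_le_one intro!: borel_measurable_times)
  have one: "(\<Sum>u\<in>X. pmf (aug z) u) = 1" if "z \<in> space M" for z
    using assms that unfolding augmentation_model_def by (intro sum_pmf_eq_1) auto
  have "(\<Sum>u\<in>X. \<Sum>v\<in>X. ?P u v) = (LINT z|M. (\<Sum>u\<in>X. \<Sum>v\<in>X. pmf (aug z) u * pmf (aug z) v))"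
    unfolding cooccurrence_def using int by (simp add: Bochner_Integration.integral_sum)
  also have "\<dots> = (LINT z|M. 1)"
    by (intro Bochner_Integration.integral_cong refl) (simp add: one flip: sum_product)
  finally have total: "(\<Sum>u\<in>X. \<Sum>v\<in>X. ?P u v) = 1" by (simp add: prob_space)
  have out: "(case p of (u, v) \<Rightarrow> ?P u v) = 0" if "p \<notin> X \<times> X" for p
    using that cooccurrence_outside[OF assms(1)] by (cases p) auto
  have "(\<integral>\<^sup>+p. ennreal (case p of (u, v) \<Rightarrow> ?P u v) \<partial>count_space UNIV)
      = (\<Sum>p\<in>X \<times> X. ennreal (case p of (u, v) \<Rightarrow> ?P u v))"
    using assms by (intro nn_integral_count_space')
      (simp_all add: out)
  also have "\<dots> = ennreal (\<Sum>p\<in>X \<times> X. case p of (u, v) \<Rightarrow> ?P u v)"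
    using nonneg by (intro sum_ennreal) auto
  also have "\<dots> = 1" using total by (simp add: sum.cartesian_product)
  finally show ?thesis
    unfolding positive_pair_def by (subst pmf_embed_pmf) (auto simp: nonneg)
qed

lemma expectation_positive_pair:
  assumes "augmentation_model X M aug" "finite X"
  shows "measure_pmf.expectation (positive_pair (cooccurrence M aug)) (\<lambda>(x, x'). g x x' :: real)
       = (\<Sum>x\<in>X. \<Sum>x'\<in>X. cooccurrence M aug x x' * g x x')"
proof -
  have "set_pmf (positive_pair (cooccurrence M aug)) \<subseteq> X \<times> X"
    using cooccurrence_outside[OF assms(1)] pmf_positive_pair[OF assms]
    by (fastforce simp: set_pmf_iff)
  then show ?thesis
    using assms by (subst integral_measure_pmf[where A = "X \<times> X"])
      (auto simp: pmf_positive_pair sum.cartesian_product case_prod_unfold intro!: sum.cong)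
qed

lemma pmf_marginal:
  fixes x :: 'a
  assumes "augmentation_model X M aug" "finite X"
  shows "pmf (map_pmf fst (positive_pair (cooccurrence M aug))) x
       = marginal X (cooccurrence M aug) x"
proof -
  let ?p = "positive_pair (cooccurrence M aug)"
  have "pmf (map_pmf fst ?p) x = measure_pmf.expectation ?p (\<lambda>(u, v). if u = x then 1 else 0)"
  proof -
    have "(\<lambda>(u, v). if u = x then 1 else 0 :: real) = indicat_real (fst -` {x} :: ('a \<times> 'a) set)"
      by (auto simp: indicator_def fun_eq_iff)
    then show ?thesis by (simp add: pmf_map)
  qed
  also have "\<dots> = (\<Sum>u\<in>X. \<Sum>v\<in>X. cooccurrence M aug u v * (if u = x then 1 else 0))"
    by (rule expectation_positive_pair[OF assms])
  also have "\<dots> = (\<Sum>u\<in>X. if u = x then marginal X (cooccurrence M aug) u else 0)"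
    by (intro sum.cong) (auto simp: marginal_def)
  also have "\<dots> = marginal X (cooccurrence M aug) x"
    using assms by (simp add: marginal_def cooccurrence_outside)
  finally show ?thesis .
qed

lemma expectation_negative_pair:
  assumes "augmentation_model X M aug" "finite X"
  shows "measure_pmf.expectation (negative_pair (cooccurrence M aug)) (\<lambda>(x, x'). g x x' :: real)
       = (\<Sum>x\<in>X. \<Sum>x'\<in>X. marginal X (cooccurrence M aug) x
            * marginal X (cooccurrence M aug) x' * g x x')"
proof -
  have "marginal X (cooccurrence M aug) x = 0" if "x \<notin> X" for x
    using that cooccurrence_outside[OF assms(1)] by (simp add: marginal_def)
  then have "set_pmf (map_pmf fst (positive_pair (cooccurrence M aug))) \<subseteq> X"
    using pmf_marginal[OF assms] unfolding set_pmf_iff subset_iff by metis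
  then have "set_pmf (negative_pair (cooccurrence M aug)) \<subseteq> X \<times> X"
    unfolding negative_pair_def set_pair_pmf by blast
  then show ?thesis
    using assms by (subst integral_measure_pmf[where A = "X \<times> X"])
      (auto simp: negative_pair_def pmf_pair pmf_marginal sum.cartesian_product case_prod_unfold
        intro!: sum.cong)
qed

end

theory Submission
  imports Defs
begin

text \<open>
  The entry of \<open>F F\<^sup>T\<close> at \<open>(x, x')\<close> is \<open>\<surd>(P x P x') (f x \<bullet> f x')\<close>, and that of the normalized adjacency
  matrix is \<open>P x x' / \<surd>(P x P x')\<close>. Expanding the square of their difference, the weights cancel in
  the cross term, which becomes the positive-pair expectation, and the quadratic term is the
  negative-pair expectation. As the marginals are positive, rescaling the rows turns every
  non-negative matrix into the feature matrix of a non-negative representation, so the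
  minimization problems correspond.
\<close>

lemma norm_matrix_power2:
  fixes A :: "real ^ 'm ^ 'n"
  shows "(norm A)\<^sup>2 = (\<Sum>i\<in>UNIV. \<Sum>j\<in>UNIV. (A $ i $ j)\<^sup>2)"
  unfolding power2_norm_eq_inner by (simp add: inner_vec_def power2_eq_square)

text \<open>The outer factors are diagonal, so each sum in the two matrix products collapses to one
  term: row \<open>i\<close> and column \<open>j\<close> are scaled separately.\<close>

lemma normalized_adjacency_nth:
  assumes "0 < marginal X P (s i)" "0 < marginal X P (s j)"
  shows "normalized_adjacency s X P $ i $ j
       = P (s i) (s j) / (sqrt (marginal X P (s i)) * sqrt (marginal X P (s j)))"
proof -
  have "x powr (- (1 / 2)) = 1 / sqrt x" if "0 < x" for x :: real
    using that by (simp add: powr_minus_divide powr_half_sqrt)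
  then show ?thesis
    using assms
    by (simp add: normalized_adjacency_def degree_inv_sqrt_def cooc_matrix_def
        matrix_matrix_mult_def mult_delta_left mult_delta_right)
qed

lemma feature_matrix_gram_nth:
  "(feature_matrix s X P f ** transpose (feature_matrix s X P f)) $ i $ j
     = sqrt (marginal X P (s i)) * sqrt (marginal X P (s j)) * (f (s i) \<bullet> f (s j))"
  by (simp add: matrix_matrix_mult_def transpose_def feature_matrix_def inner_vec_def
      sum_distrib_left mult_ac)

text \<open>This is the algebraic core, obtained entry by entry on finite sums. Probability enters
  only when \<open>theorem2\<close> reads the last two sums as expectations over pairs.\<close>

lemma L_SNMF_feature_matrix:
  fixes s :: "'n::finite \<Rightarrow> 'a" and f :: "'a \<Rightarrow> real ^ 'k"
  assumes s: "bij_betw s UNIV X"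
    and pos: "\<And>x. x \<in> X \<Longrightarrow> 0 < marginal X P x"
  shows "L_SNMF s X P (feature_matrix s X P f)
       = (\<Sum>x\<in>X. \<Sum>x'\<in>X. (P x x')\<^sup>2 / (marginal X P x * marginal X P x'))
         - 2 * (\<Sum>x\<in>X. \<Sum>x'\<in>X. P x x' * (f x \<bullet> f x'))
         + (\<Sum>x\<in>X. \<Sum>x'\<in>X. marginal X P x * marginal X P x' * (f x \<bullet> f x')\<^sup>2)"
proof -
  let ?m = "marginal X P"
  let ?e = "\<lambda>x x'. (P x x')\<^sup>2 / (?m x * ?m x') - 2 * (P x x' * (f x \<bullet> f x'))
              + ?m x * ?m x' * (f x \<bullet> f x')\<^sup>2"
  have m: "0 < ?m (s i)" for i
    using s pos by (auto simp: bij_betw_def)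
  have square: "(p / (sqrt a * sqrt b) - sqrt a * sqrt b * t)\<^sup>2
      = p\<^sup>2 / (a * b) - 2 * (p * t) + a * b * t\<^sup>2" if "0 < a" "0 < b" for a b p t :: real
    using that by (simp add: power2_diff power_mult_distrib power_divide)
  have "L_SNMF s X P (feature_matrix s X P f) = (\<Sum>i\<in>UNIV. \<Sum>j\<in>UNIV. ?e (s i) (s j))"
    unfolding L_SNMF_def norm_matrix_power2
    by (simp only: vector_minus_component normalized_adjacency_nth[OF m m]
        feature_matrix_gram_nth square[OF m m])
  \<comment> \<open>The bijection \<open>s\<close> carries the index sums over to \<open>X\<close>,
    first the inner and then the outer one.\<close>
  also have "\<dots> = (\<Sum>x\<in>X. \<Sum>x'\<in>X. ?e x x')"
    by (simp only: sum.reindex_bij_betw[OF s, of "\<lambda>x'. ?e x x'" for x]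
        sum.reindex_bij_betw[OF s, of "\<lambda>x. \<Sum>x'\<in>X. ?e x x'"])
  finally show ?thesis
    by (simp add: sum.distrib sum_subtractf sum_distrib_left)
qed

lemma nonneg_matrix_feature_matrix:
  assumes "bij_betw s UNIV X" "\<And>x. x \<in> X \<Longrightarrow> 0 < marginal X P x" "nonneg_on X f"
  shows "nonneg_matrix (feature_matrix s X P f)"
proof -
  have "s i \<in> X" for i using assms(1) by (auto simp: bij_betw_def)
  then show ?thesis
    using assms(2,3) by (auto simp: nonneg_matrix_def feature_matrix_def nonneg_on_def less_imp_le)
qed

lemma feature_matrix_surj:
  fixes s :: "'n::finite \<Rightarrow> 'a" and F :: "real ^ 'k ^ 'n"
  assumes s: "bij_betw s UNIV X"
    and pos: "\<And>x. x \<in> X \<Longrightarrow> 0 < marginal X P x"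
    and F: "nonneg_matrix F"
  obtains f where "nonneg_on X f" "feature_matrix s X P f = F"
proof -
  \<comment> \<open>Undo the row scaling: \<open>inv s x\<close> is the row belonging to
    \<open>x\<close>. Values off \<open>X\<close> are irrelevant, as both claims look at
    \<open>f\<close> on \<open>X\<close> only.\<close>
  define f where "f x = (1 / sqrt (marginal X P x)) *\<^sub>R F $ inv s x" for x
  have m: "0 < marginal X P (s i)" for i
    using s pos by (auto simp: bij_betw_def)
  have inv: "inv s (s i) = i" for i
    using s by (simp add: bij_betw_def)
  have "nonneg_on X f"
    using F pos by (auto simp: nonneg_on_def nonneg_matrix_def f_def less_imp_le)
  moreover have "feature_matrix s X P f = F"
    using m by (simp add: feature_matrix_def f_def inv vec_eq_iff less_imp_neq[OF m, symmetric])
  ultimately show thesis by (rule that)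
qed

text \<open>Translation by \<open>c\<close> maps lower bounds to lower bounds, in both directions.
  The two assumptions ensure that the real \<open>INF\<close> is a genuine greatest lower
  bound.\<close>

lemma cINF_add_const:
  fixes g :: "'a \<Rightarrow> real"
  assumes "A \<noteq> {}" "bdd_below (g ` A)"
  shows "(INF x\<in>A. g x + c) = (INF x\<in>A. g x) + c"
proof (rule cInf_eq_non_empty)
  show "(\<lambda>x. g x + c) ` A \<noteq> {}" using assms(1) by simp
  show "(INF x\<in>A. g x) + c \<le> y" if "y \<in> (\<lambda>x. g x + c) ` A" for y
    using that cINF_lower[OF assms(2)] by auto
  show "y \<le> (INF x\<in>A. g x) + c" if "\<And>z. z \<in> (\<lambda>x. g x + c) ` A \<Longrightarrow> y \<le> z" for y
  proof -
    have "y - c \<le> (INF x\<in>A. g x)"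
      using that by (intro cINF_greatest[OF assms(1)]) (simp add: diff_le_eq)
    then show ?thesis by simp
  qed
qed

theorem theorem2:
  fixes X :: "(real ^ 'd) set"
    and s :: "'n::finite \<Rightarrow> real ^ 'd"
    and M :: "'o measure"
    and aug :: "'o \<Rightarrow> (real ^ 'd) pmf"
    and P :: "real ^ 'd \<Rightarrow> real ^ 'd \<Rightarrow> real"
  assumes finite_X: "finite X"
    and enum_X: "bij_betw s UNIV X"
    and model: "augmentation_model X M aug"
    and P_eq: "P = cooccurrence M aug"
    and marginal_pos: "\<And>x. x \<in> X \<Longrightarrow> marginal X P x > 0"
  shows "(\<forall>f :: real ^ 'd \<Rightarrow> real ^ 'k. nonneg_on X f \<longrightarrow>
            nonneg_matrix (feature_matrix s X P f) \<and>
            L_SNMF s X P (feature_matrix s X P f) =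
              (\<Sum>x\<in>X. \<Sum>x'\<in>X. (P x x')\<^sup>2 / (marginal X P x * marginal X P x'))
              - 2 * measure_pmf.expectation (positive_pair P) (\<lambda>(x, x'). f x \<bullet> f x')
              + measure_pmf.expectation (negative_pair P) (\<lambda>(x, x'). (f x \<bullet> f x')\<^sup>2) \<and>
            L_SNMF s X P (feature_matrix s X P f) =
              L_NCL P f
              + (\<Sum>x\<in>X. \<Sum>x'\<in>X. (P x x')\<^sup>2 / (marginal X P x * marginal X P x'))) \<and>
         (\<forall>F :: real ^ 'k ^ 'n. nonneg_matrix F \<longrightarrow>
            (\<exists>f. nonneg_on X f \<and> feature_matrix s X P f = F)) \<and>
         (\<forall>f :: real ^ 'd \<Rightarrow> real ^ 'k. nonneg_on X f \<longrightarrow>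
            (is_arg_min (L_NCL P) (nonneg_on X) f \<longleftrightarrow>
             is_arg_min (L_SNMF s X P) nonneg_matrix (feature_matrix s X P f))) \<and>
         (INF F\<in>{F :: real ^ 'k ^ 'n. nonneg_matrix F}. L_SNMF s X P F) =
           (INF f\<in>{f :: real ^ 'd \<Rightarrow> real ^ 'k. nonneg_on X f}. L_NCL P f)
           + (\<Sum>x\<in>X. \<Sum>x'\<in>X. (P x x')\<^sup>2 / (marginal X P x * marginal X P x'))"
proof -
  let ?C = "\<Sum>x\<in>X. \<Sum>x'\<in>X. (P x x')\<^sup>2 / (marginal X P x * marginal X P x')"
  let ?\<Phi> = "feature_matrix s X P :: (real ^ 'd \<Rightarrow> real ^ 'k) \<Rightarrow> real ^ 'k ^ 'n"
  let ?A = "{f :: real ^ 'd \<Rightarrow> real ^ 'k. nonneg_on X f}"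
  let ?B = "{F :: real ^ 'k ^ 'n. nonneg_matrix F}"
  have expand: "L_SNMF s X P (?\<Phi> f)
      = ?C - 2 * measure_pmf.expectation (positive_pair P) (\<lambda>(x, x'). f x \<bullet> f x')
        + measure_pmf.expectation (negative_pair P) (\<lambda>(x, x'). (f x \<bullet> f x')\<^sup>2)" for f
    using L_SNMF_feature_matrix[OF enum_X marginal_pos, where f = f]
    by (simp only: P_eq expectation_positive_pair[OF model finite_X]
        expectation_negative_pair[OF model finite_X])
  then have shift: "L_SNMF s X P (?\<Phi> f) = L_NCL P f + ?C" for f
    by (simp add: L_NCL_def)
  have nonneg: "nonneg_matrix (?\<Phi> f)" if "nonneg_on X f" for f
    using nonneg_matrix_feature_matrix[OF enum_X marginal_pos that] .
  have surj: "\<exists>f. nonneg_on X f \<and> ?\<Phi> f = F" if "nonneg_matrix F" for F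
    using feature_matrix_surj[OF enum_X marginal_pos that] by metis
  \<comment> \<open>\<open>?\<Phi>\<close> forgets values off \<open>X\<close> and so is not
    injective; equality of the image with \<open>?B\<close> is what transfers minimizers and
    infima.\<close>
  have image: "?\<Phi> ` ?A = ?B"
    using nonneg surj by blast
  have argmin: "is_arg_min (L_NCL P) (nonneg_on X) f
      \<longleftrightarrow> is_arg_min (L_SNMF s X P) nonneg_matrix (?\<Phi> f)" if "nonneg_on X f" for f
  proof -
    \<comment> \<open>\<open>is_arg_min\<close> means that no admissible competitor is strictly
      better. Every competitor \<open>F\<close> is some \<open>?\<Phi> g\<close>, and
      \<open>?C\<close> cancels from the comparison.\<close>
    have "(\<exists>F\<in>?B. L_SNMF s X P F < L_SNMF s X P (?\<Phi> f))
        \<longleftrightarrow> (\<exists>g\<in>?A. L_SNMF s X P (?\<Phi> g) < L_SNMF s X P (?\<Phi> f))"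
      unfolding image[symmetric] by blast
    also have "\<dots> \<longleftrightarrow> (\<exists>g\<in>?A. L_NCL P g < L_NCL P f)"
      by (simp only: shift add_less_cancel_right)
    finally show ?thesis
      using that nonneg[OF that] by (simp only: is_arg_min_def Bex_def mem_Collect_eq)
  qed
  have "(\<lambda>x. 0) \<in> ?A"
    by (simp add: nonneg_on_def)
  then have nonempty: "?A \<noteq> {}"
    by blast
  \<comment> \<open>The lower bound comes from the matrix side: \<open>L_SNMF\<close> is a squared
    norm, hence non-negative, and differs from \<open>L_NCL\<close> by \<open>?C\<close>.\<close>
  have "- ?C \<le> L_NCL P f" for f :: "real ^ 'd \<Rightarrow> real ^ 'k"
  proof -
    have "0 \<le> L_SNMF s X P (?\<Phi> f)"
      by (simp add: L_SNMF_def)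
    then show ?thesis
      by (simp add: shift)
  qed
  then have bdd: "bdd_below (L_NCL P ` ?A)"
    by (intro bdd_belowI2)
  have "(INF F\<in>?B. L_SNMF s X P F) = (INF f\<in>?A. L_NCL P f + ?C)"
    by (simp only: image[symmetric] image_image shift)
  also have "\<dots> = (INF f\<in>?A. L_NCL P f) + ?C"
    by (rule cINF_add_const[OF nonempty bdd])
  finally have inf: "(INF F\<in>?B. L_SNMF s X P F) = (INF f\<in>?A. L_NCL P f) + ?C" .
  show ?thesis
    by (intro conjI allI impI nonneg expand shift surj argmin inf)
qed

end
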